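(* For every positive integer $n$, $$\sum_{\sigma\in B_n}\prod_{i\in\overleftarrow{\mathrm{Min}}_0(\sigma)}x_i\cdot\prod_{i\in\overleftarrow{\mathrm{Min}}_1(\sigma)}t_i\cdot q^{\ell(\sigma)}=\prod_{j=1}^n\bigl(x_j+q+q^2+\cdots+q^{2j-2}+q^{2j-1}t_j\bigr),$$ i.e. $(x_1+qt_1)(x_2+q+q^2+q^3t_2)\cdots(x_n+q+\cdots+q^{2n-2}+q^{2n-1}t_n)$.
   Context: $B_n=C_2\wr S_n$ is the group of signed permutations $\sigma=[\sigma(1),\dots,\sigma(n)]$ of $\{\pm1,\dots,\pm n\}$ with $\sigma(-j)=-\sigma(j)$, under composition; $|\sigma|=[|\sigma(1)|,\dots,|\sigma(n)|]\in S_n$. $\ell(\sigma)$ is the length with respect to the generators $s_0=[-1,2,\dots,n]$ and $s_i=(i,i+1)$, $1\le i\le n-1$. $\overleftarrow{\mathrm{Min}}_0(\sigma)$ (resp. $\overleftarrow{\mathrm{Min}}_1(\sigma)$) is the set of values $|\sigma(i)|$ which are right-to-left minima of $|\sigma|$ (i.e. $|\sigma(i)|<|\sigma(j)|$ for all $j>i$) with $\sigma(i)>0$ (resp. $\sigma(i)<0$). *)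

theory Defs
  imports Main "HOL-Combinatorics.Permutations"
begin

text \<open>
  A signed permutation is a function on the integers that permutes
  \<open>{-n, \<dots>, -1, 1, \<dots>, n}\<close>, is odd, and (by the convention of \<^const>\<open>permutes\<close>)
  fixes every other integer. The group operation is function composition.
\<close>

definition signed_perms :: "nat \<Rightarrow> (int \<Rightarrow> int) set" where
  "signed_perms n =
     {\<sigma>. \<sigma> permutes ({- int n..int n} - {0}) \<and> (\<forall>j. \<sigma> (- j) = - \<sigma> j)}"

text \<open>
  For \<open>i \<ge> 1\<close> the generator exchanges \<open>i\<close> and \<open>i + 1\<close> and, by oddness,
  also \<open>-i\<close> and \<open>-(i + 1)\<close>.
\<close>

definition signed_gen :: "nat \<Rightarrow> int \<Rightarrow> int" where
  "signed_gen i =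
     (if i = 0 then transpose 1 (- 1)
      else transpose (int i) (int i + 1) \<circ> transpose (- int i) (- (int i + 1)))"

text \<open>
  The word length with respect to \<open>s\<^sub>0, \<dots>, s\<^bsub>n-1\<^esub>\<close>; meaningful for
  \<open>\<sigma> \<in> signed_perms n\<close>, where the set of expressing words is nonempty.
\<close>

definition signed_length :: "nat \<Rightarrow> (int \<Rightarrow> int) \<Rightarrow> nat" where
  "signed_length n \<sigma> =
     (LEAST k. \<exists>w. length w = k \<and> set w \<subseteq> {..<n} \<and> foldr (\<circ>) (map signed_gen w) id = \<sigma>)"

definition is_rl_min :: "nat \<Rightarrow> (int \<Rightarrow> int) \<Rightarrow> nat \<Rightarrow> bool" where
  "is_rl_min n \<sigma> i \<longleftrightarrow>
     i \<in> {1..n} \<and> (\<forall>j\<in>{1..n}. i < j \<longrightarrow> \<bar>\<sigma> (int i)\<bar> < \<bar>\<sigma> (int j)\<bar>)"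

text \<open>The following are sets of values \<open>\<bar>\<sigma>(i)\<bar>\<close>, not of positions \<open>i\<close>.\<close>

definition rl_Min0 :: "nat \<Rightarrow> (int \<Rightarrow> int) \<Rightarrow> nat set" where
  "rl_Min0 n \<sigma> = {nat \<bar>\<sigma> (int i)\<bar> | i. is_rl_min n \<sigma> i \<and> \<sigma> (int i) > 0}"

definition rl_Min1 :: "nat \<Rightarrow> (int \<Rightarrow> int) \<Rightarrow> nat set" where
  "rl_Min1 n \<sigma> = {nat \<bar>\<sigma> (int i)\<bar> | i. is_rl_min n \<sigma> i \<and> \<sigma> (int i) < 0}"

end

(*
  Every element of B_(m+1) is uniquely tau c_k with tau in B_m and c_k, for 0 <= k <= 2m+1, the
  prefix of length k of the word s_m ... s_1 s_0 s_1 ... s_m. Multiplying tau on the right by the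
  successive letters moves the value m+1 from the last position to the first, flips its sign, and
  moves it back. Each letter acts on an ascent and so adds 1 to the length, giving
  l(tau c_k) = l(tau) + k. Since m+1 is the largest absolute value, it does not affect which other
  values are right-to-left minima, and it is one itself only in the last position, that is for
  k = 0 (positive) and k = 2m+1 (negative). Summing over k yields the factor with j = m+1.
*)
theory Submission
  imports Defs
begin

section \<open>The group of signed permutations and its generators\<close>

lemma signed_perms_odd: "\<sigma> \<in> signed_perms n \<Longrightarrow> \<sigma> (- j) = - \<sigma> j"
  by (simp add: signed_perms_def)

lemma signed_perms_zero [simp]: "\<sigma> \<in> signed_perms n \<Longrightarrow> \<sigma> 0 = 0"
  using signed_perms_odd[of \<sigma> n 0] by simp

lemma signed_perms_bij: "\<sigma> \<in> signed_perms n \<Longrightarrow> bij \<sigma>"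
  by (auto simp: signed_perms_def dest: permutes_bij)

lemma signed_perms_eq_iff [simp]: "\<sigma> \<in> signed_perms n \<Longrightarrow> \<sigma> a = \<sigma> b \<longleftrightarrow> a = b"
  using signed_perms_bij[of \<sigma> n] by (auto simp: bij_def inj_def)

lemma signed_perms_fix: "\<sigma> \<in> signed_perms n \<Longrightarrow> \<bar>a\<bar> > int n \<Longrightarrow> \<sigma> a = a"
  unfolding signed_perms_def by (auto intro!: permutes_not_in[of _ _ a])

lemma signed_perms_abs_le_iff:
  assumes "\<sigma> \<in> signed_perms n"
  shows "\<bar>\<sigma> a\<bar> \<le> int n \<longleftrightarrow> \<bar>a\<bar> \<le> int n"
proof (cases "a = 0")
  case False
  have "\<sigma> permutes ({- int n..int n} - {0})"
    using assms by (simp add: signed_perms_def)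
  from permutes_in_image[OF this, of a] show ?thesis
    using False signed_perms_eq_iff[OF assms, of a 0] signed_perms_zero[OF assms] by auto
qed (use assms in simp)

lemma signed_perms_comp:
  assumes "\<sigma> \<in> signed_perms n" "\<tau> \<in> signed_perms n"
  shows "\<sigma> \<circ> \<tau> \<in> signed_perms n"
  using assms by (auto simp: signed_perms_def intro: permutes_compose)

lemma signed_perms_id: "id \<in> signed_perms n"
  by (auto simp: signed_perms_def intro: permutes_id)

lemma signed_perms_inv:
  assumes "\<sigma> \<in> signed_perms n"
  shows "inv \<sigma> \<in> signed_perms n"
proof -
  have b: "bij \<sigma>" using assms by (rule signed_perms_bij)
  have "inv \<sigma> (- j) = - inv \<sigma> j" for j
  proof -
    have "\<sigma> (- inv \<sigma> j) = - j"
      using b by (simp add: signed_perms_odd[OF assms] bij_is_surj surj_f_inv_f)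
    then show ?thesis using b by (metis bij_inv_eq_iff)
  qed
  then show ?thesis using assms by (auto simp: signed_perms_def intro: permutes_inv)
qed

lemma signed_perms_0: "signed_perms 0 = {id}"
  by (auto simp: signed_perms_def)

lemma signed_perms_mono: "m \<le> n \<Longrightarrow> signed_perms m \<subseteq> signed_perms n"
  by (auto simp: signed_perms_def intro: permutes_subset)

lemma signed_perms_Suc_fix:
  assumes "\<sigma> \<in> signed_perms (Suc m)" "\<sigma> (int (Suc m)) = int (Suc m)"
  shows "\<sigma> \<in> signed_perms m"
proof -
  have "\<sigma> (- int (Suc m)) = - int (Suc m)"
    using assms signed_perms_odd by metis
  moreover have "\<sigma> permutes ({- int (Suc m)..int (Suc m)} - {0})"
    using assms by (simp add: signed_perms_def)
  ultimately have "\<sigma> permutes ({- int m..int m} - {0})"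
    using assms(2) by (elim permutes_superset) (auto simp: order_le_less)
  then show ?thesis using assms by (simp add: signed_perms_def)
qed

lemma signed_gen_apply:
  "signed_gen i a =
     (if i = 0 then if \<bar>a\<bar> = 1 then - a else a
      else if a = int i then int i + 1 else if a = int i + 1 then int i
      else if a = - int i then - int i - 1 else if a = - int i - 1 then - int i else a)"
  by (auto simp: signed_gen_def transpose_def)

lemma signed_gen_signed_perms:
  assumes "i < n"
  shows "signed_gen i \<in> signed_perms n"
proof -
  have "signed_gen i (- j) = - signed_gen i j" for j
    by (auto simp: signed_gen_apply)
  moreover have "signed_gen i permutes ({- int n..int n} - {0})"
    using assms unfolding signed_gen_def
    by (auto intro!: permutes_compose permutes_swap_id)
  ultimately show ?thesis by (simp add: signed_perms_def)
qed

lemma signed_gen_involutive [simp]: "signed_gen i (signed_gen i a) = a"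
  by (auto simp: signed_gen_apply)

lemma signed_gen_comp_self: "\<sigma> \<circ> signed_gen i \<circ> signed_gen i = \<sigma>"
  by (simp add: fun_eq_iff)

section \<open>Inversions of signed permutations\<close>

text \<open>
  The inversions form orbits under \<open>(a, b) \<mapsto> (-b, -a)\<close>. Keeping the pairs \<open>(0, b)\<close>
  but not the pairs \<open>(a, 0)\<close> compensates for the orbits \<open>{(-b, b)}\<close> of size one, so that the
  number of inversions is exactly twice the length.
\<close>

definition signed_inversions :: "(int \<Rightarrow> int) \<Rightarrow> (int \<times> int) set" where
  "signed_inversions \<sigma> = {(a, b). a < b \<and> b \<noteq> 0 \<and> \<sigma> b < \<sigma> a}"

text \<open>A pair with an entry outside \<open>{- int n..int n}\<close> keeps its order, since such
  entries are fixed and the interval is preserved. Finiteness matters because \<open>card\<close> of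
  an infinite set is 0.\<close>

lemma finite_signed_inversions:
  assumes "\<sigma> \<in> signed_perms n"
  shows "finite (signed_inversions \<sigma>)"
proof (rule finite_subset)
  show "signed_inversions \<sigma> \<subseteq> {- int n..int n} \<times> {- int n..int n}"
  proof (clarsimp simp: signed_inversions_def)
    fix a b assume "a < b" "\<sigma> b < \<sigma> a"
    then show "- int n \<le> a \<and> a \<le> int n \<and> - int n \<le> b \<and> b \<le> int n"
      using signed_perms_fix[OF assms, of a] signed_perms_fix[OF assms, of b]
        signed_perms_abs_le_iff[OF assms, of a] signed_perms_abs_le_iff[OF assms, of b]
      by linarith
  qed
qed simp

text \<open>Applying \<open>signed_gen i\<close> to both entries carries the old inversions onto the
  new ones outside a set of two pairs whose order it reverses; at an ascent exactly these two are
  gained. As \<open>\<sigma> 0 = 0\<close>, an ascent at \<open>i = 0\<close> means that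
  \<open>\<sigma> 1\<close> is positive.\<close>

lemma card_signed_inversions_gen:
  assumes \<sigma>: "\<sigma> \<in> signed_perms n" and asc: "\<sigma> (int i) < \<sigma> (int i + 1)"
  shows "card (signed_inversions (\<sigma> \<circ> signed_gen i)) = card (signed_inversions \<sigma>) + 2"
proof -
  let ?s = "signed_gen i"
  \<comment> \<open>For \<open>i = 0\<close> the pair \<open>(-1, 0)\<close> is reversed as well,
    but the condition \<open>b \<noteq> 0\<close> excludes it, so two pairs remain in both
    cases.\<close>
  define D :: "(int \<times> int) set" where
    "D = (if i = 0 then {(-1, 1), (0, 1)} else {(int i, int i + 1), (- int i - 1, - int i)})"
  have D: "finite D" "card D = 2" by (auto simp: D_def)
  have odd: "\<sigma> (- a) = - \<sigma> a" for a using \<sigma> by (rule signed_perms_odd)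
  have neg: "\<sigma> (- int i - 1) = - \<sigma> (int i + 1)" using odd[of "int i + 1"] by simp
  have ord: "?s a < ?s b \<and> ?s b \<noteq> 0 \<and> (?s a, ?s b) \<notin> D" if "a < b" "b \<noteq> 0" "(a, b) \<notin> D" for a b
    using that by (auto simp: D_def signed_gen_apply split: if_splits)
  have D1: "D \<subseteq> signed_inversions (\<sigma> \<circ> ?s)"
    using asc odd[of 1] \<sigma> odd[of "int i"] neg
    by (auto simp: D_def signed_inversions_def signed_gen_apply split: if_splits)
  have D2: "D \<inter> signed_inversions \<sigma> = {}"
    using asc odd[of 1] \<sigma> odd[of "int i"] neg
    by (auto simp: D_def signed_inversions_def split: if_splits)
  have "signed_inversions (\<sigma> \<circ> ?s) - D = map_prod ?s ?s ` signed_inversions \<sigma>"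
  proof (intro equalityI subsetI)
    fix z assume "z \<in> signed_inversions (\<sigma> \<circ> ?s) - D"
    then obtain a b where z: "z = (a, b)" and "a < b" "b \<noteq> 0" "\<sigma> (?s b) < \<sigma> (?s a)" "(a, b) \<notin> D"
      by (auto simp: signed_inversions_def)
    then have "(?s a, ?s b) \<in> signed_inversions \<sigma>"
      using ord[of a b] by (simp add: signed_inversions_def)
    moreover have "z = map_prod ?s ?s (?s a, ?s b)" by (simp add: z)
    ultimately show "z \<in> map_prod ?s ?s ` signed_inversions \<sigma>" by (rule rev_image_eqI)
  next
    fix z assume "z \<in> map_prod ?s ?s ` signed_inversions \<sigma>"
    then obtain a b where ab: "(a, b) \<in> signed_inversions \<sigma>" and z: "z = (?s a, ?s b)" by auto
    then have "(a, b) \<notin> D" using D2 by auto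
    then show "z \<in> signed_inversions (\<sigma> \<circ> ?s) - D"
      using ab z ord[of a b] by (auto simp: signed_inversions_def)
  qed
  moreover have "inj (map_prod ?s ?s)"
    by (rule inj_on_inverseI[where g = "map_prod ?s ?s"]) auto
  ultimately have "card (signed_inversions (\<sigma> \<circ> ?s) - D) = card (signed_inversions \<sigma>)"
    by (simp add: card_image inj_on_subset)
  \<comment> \<open>There is no bound on \<open>i\<close> that would place
    \<open>\<sigma> \<circ> ?s\<close> in \<open>signed_perms n\<close>; finiteness is read off from
    the image just computed.\<close>
  moreover have "finite (signed_inversions (\<sigma> \<circ> ?s))"
    using \<open>_ - D = _\<close> D(1) finite_signed_inversions[OF \<sigma>] by (metis finite_Diff2 finite_imageI)
  then have "card (signed_inversions (\<sigma> \<circ> ?s)) = card (signed_inversions (\<sigma> \<circ> ?s) - D) + card D"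
    using D1 D(1) by (metis add.commute card_Diff_subset card_mono le_add_diff_inverse)
  ultimately show ?thesis using D by simp
qed

text \<open>At a descent, \<open>\<sigma> \<circ> signed_gen i\<close> has an ascent at
  \<open>i\<close>, and a second multiplication by the involution returns to
  \<open>\<sigma>\<close>, so the count drops by 2.\<close>

lemma card_signed_inversions_gen_le:
  assumes \<sigma>: "\<sigma> \<in> signed_perms n" and "i < n"
  shows "card (signed_inversions (\<sigma> \<circ> signed_gen i)) \<le> card (signed_inversions \<sigma>) + 2"
proof (cases "\<sigma> (int i) < \<sigma> (int i + 1)")
  case False
  let ?\<rho> = "\<sigma> \<circ> signed_gen i"
  have \<rho>: "?\<rho> \<in> signed_perms n"
    using assms by (intro signed_perms_comp signed_gen_signed_perms)
  have "\<sigma> (int i) \<noteq> \<sigma> (int i + 1)" using \<sigma> by simp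
  then have "\<sigma> (int i + 1) < \<sigma> (int i)" using False by linarith
  then have "?\<rho> (int i) < ?\<rho> (int i + 1)"
    using \<sigma> signed_perms_odd[OF \<sigma>, of 1] by (auto simp: signed_gen_apply)
  from card_signed_inversions_gen[OF \<rho> this] show ?thesis
    unfolding signed_gen_comp_self by linarith
qed (use card_signed_inversions_gen[OF \<sigma>] in simp)

lemma card_signed_inversions_id: "card (signed_inversions id) = 0"
proof -
  have "signed_inversions id = {}" by (auto simp: signed_inversions_def)
  then show ?thesis by simp
qed

section \<open>Words in the generators\<close>

definition signed_word :: "nat list \<Rightarrow> int \<Rightarrow> int" where
  "signed_word w = foldr (\<circ>) (map signed_gen w) id"

lemma signed_word_Nil: "signed_word [] = id"
  unfolding signed_word_def by simp

lemma signed_word_Cons: "signed_word (i # w) = signed_gen i \<circ> signed_word w"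
  unfolding signed_word_def list.map foldr.simps comp_apply ..

lemma signed_word_append: "signed_word (v @ w) = signed_word v \<circ> signed_word w"
proof (induction v)
  case Nil
  show ?case unfolding append_Nil signed_word_Nil id_comp ..
next
  case (Cons i v)
  then show ?case unfolding append_Cons signed_word_Cons comp_assoc by (rule arg_cong)
qed

lemma signed_word_snoc: "signed_word (w @ [i]) = signed_word w \<circ> signed_gen i"
  unfolding signed_word_append signed_word_Cons signed_word_Nil comp_id ..

text \<open>Starting from none for \<open>id\<close>, each letter appended on the right adds at most
  two inversions. This gives the lower bound for the length.\<close>

lemma signed_word_inversions:
  assumes "set w \<subseteq> {..<n}"
  shows "signed_word w \<in> signed_perms n \<and> card (signed_inversions (signed_word w)) \<le> 2 * length w"
  using assms
proof (induction w rule: rev_induct)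
  case Nil
  show ?case
    unfolding signed_word_Nil using signed_perms_id card_signed_inversions_id by (metis zero_le)
next
  case (snoc i w)
  then have w: "signed_word w \<in> signed_perms n"
    and c: "card (signed_inversions (signed_word w)) \<le> 2 * length w" and i: "i < n" by auto
  show ?case
    unfolding signed_word_snoc
  proof
    show "signed_word w \<circ> signed_gen i \<in> signed_perms n"
      using w i by (intro signed_perms_comp signed_gen_signed_perms)
    show "card (signed_inversions (signed_word w \<circ> signed_gen i)) \<le> 2 * length (w @ [i])"
      using card_signed_inversions_gen_le[OF w i] c unfolding length_append by simp
  qed
qed

section \<open>Coset representatives and the factorization of
  \<open>signed_perms (Suc m)\<close>\<close>

text \<open>
  The \<open>k\<close>-th minimal coset representative of \<open>signed_perms (Suc m)\<close> modulo \<open>signed_perms m\<close>: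
  the prefix of length \<open>k\<close> of the word \<open>s\<^sub>m \<dots> s\<^sub>1 s\<^sub>0 s\<^sub>1 \<dots> s\<^sub>m\<close>.
\<close>

definition coset_word :: "nat \<Rightarrow> nat \<Rightarrow> nat list" where
  "coset_word m k = map (\<lambda>l. nat \<bar>int m - int l\<bar>) [0..<k]"

definition coset_rep :: "nat \<Rightarrow> nat \<Rightarrow> int \<Rightarrow> int" where
  "coset_rep m k = signed_word (coset_word m k)"

lemma coset_rep_0 [simp]: "coset_rep m 0 = id"
  by (simp add: coset_rep_def coset_word_def signed_word_Nil)

lemma coset_rep_Suc: "coset_rep m (Suc k) = coset_rep m k \<circ> signed_gen (nat \<bar>int m - int k\<bar>)"
  unfolding coset_rep_def coset_word_def
  by (simp only: upt_Suc_append[OF le0] map_append list.map signed_word_snoc)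

lemma coset_word_subset: "k \<le> 2 * m + 1 \<Longrightarrow> set (coset_word m k) \<subseteq> {..<Suc m}"
  by (auto simp: coset_word_def)

lemma length_coset_word [simp]: "length (coset_word m k) = k"
  by (simp add: coset_word_def)

lemma coset_rep_signed_perms: "k \<le> 2 * m + 1 \<Longrightarrow> coset_rep m k \<in> signed_perms (Suc m)"
  unfolding coset_rep_def using signed_word_inversions[OF coset_word_subset] by blast

text \<open>The argument at which \<open>coset_rep m k\<close> takes the value \<open>m + 1\<close>.
  It runs through \<open>m + 1, ..., 1, -1, ..., - (m + 1)\<close>; skipping 0 causes the shift
  between the branches.\<close>

definition coset_pos :: "nat \<Rightarrow> nat \<Rightarrow> int" where
  "coset_pos m k = (if k \<le> m then int m + 1 - int k else int m - int k)"

text \<open>Each further letter swaps the entry of absolute value \<open>m + 1\<close> with its left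
  neighbour while \<open>k < m\<close>, flips its sign at \<open>k = m\<close>, and swaps it with
  its right neighbour afterwards. The entries \<open>1, ..., m\<close> keep their relative
  order.\<close>

lemma coset_rep_apply:
  assumes "k \<le> 2 * m + 1" "1 \<le> a" "a \<le> int m + 1"
  shows "coset_rep m k a =
    (if a < \<bar>coset_pos m k\<bar> then a else if \<bar>coset_pos m k\<bar> < a then a - 1
     else sgn (coset_pos m k) * (int m + 1))"
  using assms
proof (induction k arbitrary: a)
  case 0
  then show ?case by (auto simp: coset_pos_def)
next
  case (Suc k)
  have odd: "coset_rep m k (- b) = - coset_rep m k b" for b
    using Suc.prems by (intro signed_perms_odd[OF coset_rep_signed_perms]) auto
  consider "k < m" | "k = m" | "k > m" by linarith
  then show ?case
  proof cases
    case 1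
    then have "signed_gen (nat \<bar>int m - int k\<bar>) a =
      (if a = int m - int k then a + 1 else if a = int m - int k + 1 then a - 1 else a)"
      using Suc.prems by (auto simp: signed_gen_apply)
    then show ?thesis
      using 1 Suc.prems by (auto simp: coset_rep_Suc Suc.IH coset_pos_def)
  next
    case 2
    then have "signed_gen (nat \<bar>int m - int k\<bar>) a = (if a = 1 then - a else a)"
      using Suc.prems by (auto simp: signed_gen_apply)
    then show ?thesis
      using 2 Suc.prems Suc.IH[of a] Suc.IH[of 1] odd[of 1]
      by (auto simp: coset_rep_Suc coset_pos_def)
  next
    case 3
    then have "signed_gen (nat \<bar>int m - int k\<bar>) a =
      (if a = int k - int m then a + 1 else if a = int k - int m + 1 then a - 1 else a)"
      using Suc.prems by (auto simp: signed_gen_apply)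
    then show ?thesis
      using 3 Suc.prems by (auto simp: coset_rep_Suc Suc.IH coset_pos_def)
  qed
qed

lemma coset_rep_pos:
  assumes "k \<le> 2 * m + 1"
  shows "coset_rep m k (coset_pos m k) = int m + 1"
proof (cases "k \<le> m")
  case True
  then show ?thesis using coset_rep_apply[OF assms, of "coset_pos m k"] by (auto simp: coset_pos_def)
next
  case False
  then show ?thesis
    using coset_rep_apply[OF assms, of "- coset_pos m k"] assms
      signed_perms_odd[OF coset_rep_signed_perms[OF assms], of "coset_pos m k"]
    by (auto simp: coset_pos_def)
qed

lemma coset_pos_bij:
  "bij_betw (coset_pos m) {..2 * m + 1} ({- int (Suc m)..int (Suc m)} - {0})"
proof (rule bij_betwI')
  show "coset_pos m k = coset_pos m l \<longleftrightarrow> k = l" for k l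
    by (auto simp: coset_pos_def)
  show "coset_pos m k \<in> {- int (Suc m)..int (Suc m)} - {0}" if "k \<in> {..2 * m + 1}" for k
    using that by (auto simp: coset_pos_def)
  show "\<exists>k\<in>{..2 * m + 1}. p = coset_pos m k" if "p \<in> {- int (Suc m)..int (Suc m)} - {0}" for p
    using that
    \<comment> \<open>The witness solves the two branches of \<open>coset_pos\<close> for
      \<open>k\<close>.\<close>
    by (intro bexI[of _ "nat (if p > 0 then int m + 1 - p else int m - p)"]) (auto simp: coset_pos_def)
qed

lemma signed_perms_Suc_fix_top: "\<tau> \<in> signed_perms m \<Longrightarrow> \<tau> (int m + 1) = int m + 1"
  by (simp add: signed_perms_fix)

text \<open>Since \<open>\<tau>\<close> fixes \<open>m + 1\<close>, the place where the product
  takes this value determines \<open>k\<close>, and cancelling \<open>coset_rep m k\<close>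
  determines \<open>\<tau>\<close>. Conversely, choosing \<open>k\<close> by that place leaves a
  quotient that fixes \<open>m + 1\<close> and hence lies in \<open>signed_perms m\<close>.\<close>

lemma signed_perms_coset_bij:
  "bij_betw (\<lambda>(\<tau>, k). \<tau> \<circ> coset_rep m k) (signed_perms m \<times> {..2 * m + 1}) (signed_perms (Suc m))"
  unfolding bij_betw_def
proof (intro conjI inj_onI equalityI subsetI)
  note mono = subsetD[OF signed_perms_mono[OF le_SucI[OF order_refl]]]
  { fix z z' assume "z \<in> signed_perms m \<times> {..2 * m + 1}" "z' \<in> signed_perms m \<times> {..2 * m + 1}"
      and eq: "(case z of (\<tau>, k) \<Rightarrow> \<tau> \<circ> coset_rep m k) = (case z' of (\<tau>, k) \<Rightarrow> \<tau> \<circ> coset_rep m k)"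
    then obtain \<tau> k \<tau>' k' where z: "z = (\<tau>, k)" "z' = (\<tau>', k')"
      and \<tau>: "\<tau> \<in> signed_perms m" "\<tau>' \<in> signed_perms m" and k: "k \<le> 2 * m + 1" "k' \<le> 2 * m + 1"
      by auto
    have eq: "\<tau> \<circ> coset_rep m k = \<tau>' \<circ> coset_rep m k'" using eq z by simp
    \<comment> \<open>Both sides equal \<open>m + 1\<close>.\<close>
    have "(\<tau> \<circ> coset_rep m k) (coset_pos m k) = (\<tau>' \<circ> coset_rep m k') (coset_pos m k')"
      using \<tau> k by (simp add: coset_rep_pos signed_perms_Suc_fix_top)
    moreover have "\<tau> \<circ> coset_rep m k \<in> signed_perms (Suc m)"
      using \<tau> k by (intro signed_perms_comp mono coset_rep_signed_perms)
    ultimately have "coset_pos m k = coset_pos m k'"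
      unfolding eq[symmetric] using signed_perms_eq_iff by blast
    then have kk: "k = k'" by (auto simp: coset_pos_def split: if_splits)
    have "surj (coset_rep m k')" using signed_perms_bij[OF coset_rep_signed_perms[OF k(2)]] by (rule bij_is_surj)
    then have "\<tau> = \<tau>'" using eq kk by (metis comp_apply surjD ext)
    then show "z = z'" using z kk by simp }
  { fix \<sigma> assume "\<sigma> \<in> (\<lambda>(\<tau>, k). \<tau> \<circ> coset_rep m k) ` (signed_perms m \<times> {..2 * m + 1})"
    then show "\<sigma> \<in> signed_perms (Suc m)"
      using signed_perms_comp[OF mono coset_rep_signed_perms] by auto }
  { fix \<sigma> assume \<sigma>: "\<sigma> \<in> signed_perms (Suc m)"
    define p where "p = inv \<sigma> (int m + 1)"
    have \<sigma>p: "\<sigma> p = int m + 1"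
      unfolding p_def using signed_perms_bij[OF \<sigma>] by (simp add: bij_is_surj surj_f_inv_f)
    have "p \<noteq> 0" using \<sigma>p signed_perms_zero[OF \<sigma>] by auto
    then have "p \<in> {- int (Suc m)..int (Suc m)} - {0}"
      using signed_perms_abs_le_iff[OF \<sigma>, of p] \<sigma>p by auto
    then have "p \<in> coset_pos m ` {..2 * m + 1}"
      using bij_betw_imp_surj_on[OF coset_pos_bij, of m] by (simp only:)
    then obtain k where k: "k \<le> 2 * m + 1" "p = coset_pos m k"
      by auto
    define c where "c = coset_rep m k"
    have c: "c \<in> signed_perms (Suc m)" unfolding c_def by (rule coset_rep_signed_perms) fact
    have "inv c (int m + 1) = p"
      using coset_rep_pos[OF k(1)] signed_perms_bij[OF c] k(2) c_def by (metis bij_inv_eq_iff)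
    then have "(\<sigma> \<circ> inv c) (int (Suc m)) = int (Suc m)"
      using \<sigma>p by (simp add: add.commute)
    with signed_perms_comp[OF \<sigma> signed_perms_inv[OF c]] have "\<sigma> \<circ> inv c \<in> signed_perms m"
      by (rule signed_perms_Suc_fix)
    moreover have "\<sigma> = (\<sigma> \<circ> inv c) \<circ> c"
      using signed_perms_bij[OF c] by (simp add: comp_assoc bij_is_inj)
    ultimately show "\<sigma> \<in> (\<lambda>(\<tau>, k). \<tau> \<circ> coset_rep m k) ` (signed_perms m \<times> {..2 * m + 1})"
      using k(1) c_def by (intro image_eqI[where x = "(\<sigma> \<circ> inv c, k)"]) auto }
qed

text \<open>Each letter of \<open>coset_word m k\<close> acts at an ascent and so adds exactly two
  inversions.\<close>

lemma card_signed_inversions_coset: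
  assumes \<tau>: "\<tau> \<in> signed_perms m" and "k \<le> 2 * m + 1"
  shows "card (signed_inversions (\<tau> \<circ> coset_rep m k)) = card (signed_inversions \<tau>) + 2 * k"
  using assms(2)
proof (induction k)
  case (Suc k)
  let ?i = "nat \<bar>int m - int k\<bar>" and ?\<sigma> = "\<tau> \<circ> coset_rep m k"
  have k: "k \<le> 2 * m + 1" using Suc.prems by simp
  have \<sigma>: "?\<sigma> \<in> signed_perms (Suc m)"
    using \<tau> k signed_perms_mono[of m "Suc m"] by (intro signed_perms_comp coset_rep_signed_perms) auto
  have top: "\<tau> (int m + 1) = int m + 1" using \<tau> by (rule signed_perms_Suc_fix_top)
  have bot: "\<tau> (- int m - 1) = - int m - 1"
    using \<tau> by (simp add: signed_perms_fix)
  have bd: "\<bar>\<tau> a\<bar> \<le> int m" if "\<bar>a\<bar> \<le> int m" for a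
    using signed_perms_abs_le_iff[OF \<tau>] that by simp
  note c = coset_rep_apply[OF k]
  consider "k < m" | "k = m" | "k > m" by linarith
  \<comment> \<open>One of the two entries is extreme: \<open>m + 1\<close> on the right if
    \<open>k \<le> m\<close> (with 0 at position 0 on the left if \<open>k = m\<close>), and
    \<open>- (m + 1)\<close> on the left if \<open>k > m\<close>.\<close>
  then have "?\<sigma> (int ?i) < ?\<sigma> (int ?i + 1)"
  proof cases
    case 1
    then have "coset_rep m k (int ?i) = int m - int k" "coset_rep m k (int ?i + 1) = int m + 1"
      using c[of "int ?i"] c[of "int ?i + 1"] by (auto simp: coset_pos_def)
    then show ?thesis using 1 top bd[of "int m - int k"] by simp
  next
    case 2
    then have "coset_rep m k 1 = int m + 1"
      using c[of 1] by (auto simp: coset_pos_def)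
    moreover have "?\<sigma> 0 = 0" using \<sigma> by (rule signed_perms_zero)
    ultimately show ?thesis using 2 top by simp
  next
    case 3
    then have "coset_rep m k (int ?i) = - int m - 1" "coset_rep m k (int ?i + 1) = int k - int m"
      using c[of "int ?i"] c[of "int ?i + 1"] Suc.prems by (auto simp: coset_pos_def)
    then show ?thesis using 3 Suc.prems bot bd[of "int k - int m"] by simp
  qed
  from card_signed_inversions_gen[OF \<sigma> this] show ?case
    unfolding coset_rep_Suc comp_assoc mult_Suc_right using Suc.IH[OF k] by linarith
qed simp

section \<open>The length as half the number of inversions\<close>

text \<open>Appending the coset words of the successive factors produces a word that attains the
  lower bound.\<close>

lemma ex_signed_word:
  assumes "\<sigma> \<in> signed_perms n"
  shows "\<exists>w. set w \<subseteq> {..<n} \<and> signed_word w = \<sigma> \<and> 2 * length w = card (signed_inversions \<sigma>)"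
  using assms
proof (induction n arbitrary: \<sigma>)
  case 0
  then have "\<sigma> = signed_word []" "card (signed_inversions \<sigma>) = 0"
    using card_signed_inversions_id by (simp_all only: signed_perms_0 singleton_iff signed_word_Nil)
  then show ?case by (intro exI[of _ "[]"]) simp
next
  case (Suc m)
  then have "\<sigma> \<in> (\<lambda>(\<tau>, k). \<tau> \<circ> coset_rep m k) ` (signed_perms m \<times> {..2 * m + 1})"
    using bij_betw_imp_surj_on[OF signed_perms_coset_bij, of m] by (simp only:)
  then obtain \<tau> k where \<tau>: "\<tau> \<in> signed_perms m" and k: "k \<le> 2 * m + 1"
    and \<sigma>: "\<sigma> = \<tau> \<circ> coset_rep m k"
    by auto
  from Suc.IH[OF \<tau>] obtain w where w: "set w \<subseteq> {..<m}" "signed_word w = \<tau>"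
    "2 * length w = card (signed_inversions \<tau>)" by blast
  have "signed_word (w @ coset_word m k) = \<sigma>"
    unfolding signed_word_append w(2) \<sigma> coset_rep_def ..
  moreover have "2 * length (w @ coset_word m k) = card (signed_inversions \<sigma>)"
    using w(3) card_signed_inversions_coset[OF \<tau> k] \<sigma> by simp
  moreover have "set (w @ coset_word m k) \<subseteq> {..<Suc m}"
    using w(1) coset_word_subset[OF k] by auto
  ultimately show ?case by blast
qed

lemma signed_length_inversions:
  assumes "\<sigma> \<in> signed_perms n"
  shows "2 * signed_length n \<sigma> = card (signed_inversions \<sigma>)"
proof -
  from ex_signed_word[OF assms] obtain w where w: "set w \<subseteq> {..<n}" "signed_word w = \<sigma>"
    "2 * length w = card (signed_inversions \<sigma>)" by blast
  have "signed_length n \<sigma> = length w"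
    unfolding signed_length_def signed_word_def[symmetric]
  proof (rule Least_equality)
    show "\<exists>v. length v = length w \<and> set v \<subseteq> {..<n} \<and> signed_word v = \<sigma>"
      using w by blast
    show "length w \<le> l" if "\<exists>v. length v = l \<and> set v \<subseteq> {..<n} \<and> signed_word v = \<sigma>" for l
      using that signed_word_inversions[of _ n] w(3) by fastforce
  qed
  then show ?thesis using w(3) by simp
qed

text \<open>The two lengths refer to different generating sets; they are compared through the
  inversion count, which does not depend on \<open>n\<close>.\<close>

lemma signed_length_coset:
  assumes "\<tau> \<in> signed_perms m" "k \<le> 2 * m + 1"
  shows "signed_length (Suc m) (\<tau> \<circ> coset_rep m k) = signed_length m \<tau> + k"
proof -
  have "\<tau> \<circ> coset_rep m k \<in> signed_perms (Suc m)"
    using assms signed_perms_mono[of m "Suc m"]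
    by (intro signed_perms_comp coset_rep_signed_perms) auto
  from signed_length_inversions[OF this] show ?thesis
    using card_signed_inversions_coset[OF assms] signed_length_inversions[OF assms(1)] by simp
qed

section \<open>Right-to-left minima under the factorization\<close>

text \<open>The sign \<open>e\<close> is a parameter so that one argument serves both
  \<open>rl_Min0\<close> and \<open>rl_Min1\<close>.\<close>

definition signed_rl_Min :: "int \<Rightarrow> nat \<Rightarrow> (int \<Rightarrow> int) \<Rightarrow> nat set" where
  "signed_rl_Min e n \<sigma> = {nat \<bar>\<sigma> (int i)\<bar> | i. is_rl_min n \<sigma> i \<and> sgn (\<sigma> (int i)) = e}"

lemma rl_Min0_eq: "rl_Min0 n \<sigma> = signed_rl_Min 1 n \<sigma>"
  unfolding rl_Min0_def signed_rl_Min_def sgn_if by (intro Collect_cong ex_cong1) auto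

lemma rl_Min1_eq: "rl_Min1 n \<sigma> = signed_rl_Min (- 1) n \<sigma>"
  unfolding rl_Min1_def signed_rl_Min_def sgn_if by (intro Collect_cong ex_cong1) auto

lemma signed_rl_Min_subset:
  assumes "\<sigma> \<in> signed_perms n"
  shows "signed_rl_Min e n \<sigma> \<subseteq> {..n}"
proof
  fix v assume "v \<in> signed_rl_Min e n \<sigma>"
  then obtain i where "i \<in> {1..n}" "v = nat \<bar>\<sigma> (int i)\<bar>"
    by (auto simp: signed_rl_Min_def is_rl_min_def)
  then show "v \<in> {..n}" using signed_perms_abs_le_iff[OF assms, of "int i"] by auto
qed

text \<open>Inserting an entry of largest absolute value leaves the status of all other entries
  unchanged, and the new entry is a minimum only in the last position.\<close>

lemma signed_rl_Min_coset:
  assumes \<tau>: "\<tau> \<in> signed_perms m" and k: "k \<le> 2 * m + 1"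
  shows "signed_rl_Min e (Suc m) (\<tau> \<circ> coset_rep m k) =
    signed_rl_Min e m \<tau> \<union>
      (if k = 0 \<and> e = 1 \<or> k = 2 * m + 1 \<and> e = - 1 then {Suc m} else {})"
proof -
  define \<sigma> where "\<sigma> = \<tau> \<circ> coset_rep m k"
  define p where "p = nat \<bar>coset_pos m k\<bar>"
  have p: "1 \<le> p" "p \<le> Suc m" using k by (auto simp: p_def coset_pos_def)
  have top: "\<tau> (int m + 1) = int m + 1" using \<tau> by (rule signed_perms_Suc_fix_top)
  have bot: "\<tau> (- int m - 1) = - int m - 1" using \<tau> by (simp add: signed_perms_fix)
  have bd: "\<bar>\<tau> a\<bar> \<le> int m" if "\<bar>a\<bar> \<le> int m" for a
    using signed_perms_abs_le_iff[OF \<tau>] that by simp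
  have lo: "\<sigma> (int i) = \<tau> (int i)" if "1 \<le> i" "i < p" for i
    using that p coset_rep_apply[OF k, of "int i"] by (auto simp: \<sigma>_def p_def)
  have hi: "\<sigma> (int (Suc i)) = \<tau> (int i)" if "p \<le> i" "i \<le> m" for i
    using that p coset_rep_apply[OF k, of "int (Suc i)"] by (auto simp: \<sigma>_def p_def)
  have at: "\<sigma> (int p) = sgn (coset_pos m k) * (int m + 1)"
    using p top bot coset_rep_apply[OF k, of "int p"]
    by (auto simp: \<sigma>_def p_def sgn_if)
  have absat: "\<bar>\<sigma> (int p)\<bar> = int m + 1"
    using at p by (auto simp: p_def abs_mult sgn_if)
  \<comment> \<open>The increasing renumbering of the old positions that leaves \<open>p\<close>
    free for the new entry.\<close>
  define g where "g i = (if i < p then i else Suc i)" for i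
  have g: "\<sigma> (int (g i)) = \<tau> (int i)" if "i \<in> {1..m}" for i
    using that lo[of i] hi[of i] by (auto simp: g_def)
  have g_less: "g i < g j \<longleftrightarrow> i < j" for i j by (auto simp: g_def)
  have split: "{1..Suc m} = insert p (g ` {1..m})"
  proof (intro equalityI subsetI)
    fix i assume i: "i \<in> {1..Suc m}"
    consider "i < p" | "i = p" | "i > p" by linarith
    then show "i \<in> insert p (g ` {1..m})"
    proof cases
      case 1 then show ?thesis using i p by (intro insertI2 image_eqI[of _ _ i]) (auto simp: g_def)
    next
      case 3 then show ?thesis using i p by (intro insertI2 image_eqI[of _ _ "i - 1"]) (auto simp: g_def)
    qed simp
  qed (use p in \<open>auto simp: g_def\<close>)
  have gp: "g i \<noteq> p" for i by (auto simp: g_def)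
  \<comment> \<open>The only additional comparison is with position \<open>p\<close>, and it holds
    because \<open>\<tau>\<close> has absolute values at most \<open>m\<close> on
    \<open>{1..m}\<close>.\<close>
  have min_g: "is_rl_min (Suc m) \<sigma> (g i) \<longleftrightarrow> is_rl_min m \<tau> i" if i: "i \<in> {1..m}" for i
  proof -
    have "g i \<in> {1..Suc m}" using i split by blast
    moreover have "\<bar>\<tau> (int i)\<bar> < int m + 1" using bd[of "int i"] i by auto
    ultimately show ?thesis
      unfolding is_rl_min_def split using i absat by (auto simp: g g_less)
  qed
  have min_p: "is_rl_min (Suc m) \<sigma> p \<longleftrightarrow> p = Suc m"
  proof
    assume r: "is_rl_min (Suc m) \<sigma> p"
    show "p = Suc m"
    proof (rule ccontr)
      assume "p \<noteq> Suc m"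
      then have "\<bar>\<sigma> (int p)\<bar> < \<bar>\<sigma> (int (Suc m))\<bar>" "p \<le> m"
        using r p unfolding is_rl_min_def by (auto simp del: of_nat_Suc)
      moreover have "\<bar>\<sigma> (int (Suc m))\<bar> \<le> int m" using hi[of m] \<open>p \<le> m\<close> bd[of "int m"] by simp
      ultimately show False using absat by simp
    qed
  qed (auto simp: is_rl_min_def)
  have "signed_rl_Min e (Suc m) \<sigma> =
      (\<lambda>i. nat \<bar>\<sigma> (int i)\<bar>) ` {i \<in> {1..Suc m}. is_rl_min (Suc m) \<sigma> i \<and> sgn (\<sigma> (int i)) = e}"
    unfolding signed_rl_Min_def by (auto simp: is_rl_min_def)
  also have "{i \<in> {1..Suc m}. is_rl_min (Suc m) \<sigma> i \<and> sgn (\<sigma> (int i)) = e} =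
      g ` {i \<in> {1..m}. is_rl_min m \<tau> i \<and> sgn (\<tau> (int i)) = e} \<union>
      (if p = Suc m \<and> sgn (\<sigma> (int p)) = e then {p} else {})"
    unfolding split using min_g min_p g by auto
  also have "(\<lambda>i. nat \<bar>\<sigma> (int i)\<bar>) ` \<dots> =
      (\<lambda>i. nat \<bar>\<tau> (int i)\<bar>) ` {i \<in> {1..m}. is_rl_min m \<tau> i \<and> sgn (\<tau> (int i)) = e} \<union>
      (if p = Suc m \<and> sgn (\<sigma> (int p)) = e then {nat \<bar>\<sigma> (int p)\<bar>} else {})"
    unfolding image_Un image_image using g by (intro arg_cong2[where f = "(\<union>)"] image_cong) auto
  also have "(\<lambda>i. nat \<bar>\<tau> (int i)\<bar>) ` {i \<in> {1..m}. is_rl_min m \<tau> i \<and> sgn (\<tau> (int i)) = e} =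
      signed_rl_Min e m \<tau>"
    unfolding signed_rl_Min_def by (auto simp: is_rl_min_def)
  also have "nat \<bar>\<sigma> (int p)\<bar> = Suc m" using absat by simp
  \<comment> \<open>The last position occurs at the two ends of the range of \<open>k\<close>, with
    positive sign for \<open>k = 0\<close> and negative sign for
    \<open>k = 2 * m + 1\<close>.\<close>
  also have "p = Suc m \<and> sgn (\<sigma> (int p)) = e \<longleftrightarrow> k = 0 \<and> e = 1 \<or> k = 2 * m + 1 \<and> e = - 1"
    unfolding at using k by (auto simp: p_def coset_pos_def sgn_mult)
  finally show ?thesis unfolding \<sigma>_def .
qed

lemma prod_signed_rl_Min_coset:
  fixes f :: "nat \<Rightarrow> 'a::comm_monoid_mult"
  assumes "\<tau> \<in> signed_perms m" "k \<le> 2 * m + 1"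
  shows "prod f (signed_rl_Min e (Suc m) (\<tau> \<circ> coset_rep m k)) =
    prod f (signed_rl_Min e m \<tau>) *
      (if k = 0 \<and> e = 1 \<or> k = 2 * m + 1 \<and> e = - 1 then f (Suc m) else 1)"
proof -
  have "finite (signed_rl_Min e m \<tau>)" "Suc m \<notin> signed_rl_Min e m \<tau>"
    using signed_rl_Min_subset[OF assms(1), of e] by (auto dest: finite_subset)
  then show ?thesis
    unfolding signed_rl_Min_coset[OF assms] by (auto simp: mult.commute)
qed

section \<open>Summation by induction on \<open>n\<close>\<close>

theorem theorem7p1:
  fixes n :: nat and x t :: "nat \<Rightarrow> 'a::comm_ring_1" and q :: 'a
  assumes "n \<ge> 1"
  shows "(\<Sum>\<sigma>\<in>signed_perms n.
            (\<Prod>i\<in>rl_Min0 n \<sigma>. x i) * (\<Prod>i\<in>rl_Min1 n \<sigma>. t i) * q ^ signed_length n \<sigma>)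
         = (\<Prod>j=1..n. x j + (\<Sum>k=1..2*j-2. q ^ k) + q ^ (2*j-1) * t j)"
proof -
  define W where "W n \<sigma> = prod x (signed_rl_Min 1 n \<sigma>) * prod t (signed_rl_Min (- 1) n \<sigma>) *
    q ^ signed_length n \<sigma>" for n \<sigma>
  have "sum (W n) (signed_perms n) = (\<Prod>j=1..n. x j + (\<Sum>k=1..2*j-2. q ^ k) + q ^ (2*j-1) * t j)"
  proof (induction n)
    case 0
    have "signed_length 0 id = 0"
      using signed_length_inversions[OF signed_perms_id] card_signed_inversions_id by simp
    then have "W 0 id = 1"
      unfolding W_def by (simp only:) (simp add: signed_rl_Min_def is_rl_min_def)
    then show ?case
      by (subst signed_perms_0, subst sum.insert) simp_all
  next
    case (Suc m)
    \<comment> \<open>The contribution of the coset representative alone; the weight of a product is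
      \<open>W m \<tau> * w k\<close>, so the double sum factors.\<close>
    define w where "w k = (if k = 0 then x (Suc m) else 1) *
      (if k = 2 * m + 1 then t (Suc m) else 1) * q ^ k" for k
    have "W (Suc m) (\<tau> \<circ> coset_rep m k) = W m \<tau> * w k"
      if "\<tau> \<in> signed_perms m" "k \<le> 2 * m + 1" for \<tau> k
      using that unfolding W_def w_def
      by (simp add: prod_signed_rl_Min_coset signed_length_coset power_add mult_ac)
    then have "sum (W (Suc m)) (signed_perms (Suc m)) =
        (\<Sum>(\<tau>, k)\<in>signed_perms m \<times> {..2 * m + 1}. W m \<tau> * w k)"
      by (subst sum.reindex_bij_betw[OF signed_perms_coset_bij, symmetric])
        (auto intro!: sum.cong)
    also have "\<dots> = sum (W m) (signed_perms m) * sum w {..2 * m + 1}"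
      unfolding sum_product sum.cartesian_product ..
    also have "sum w {..2 * m + 1} = x (Suc m) + (\<Sum>k=1..2*m. q ^ k) + q ^ (2*m+1) * t (Suc m)"
    proof -
      \<comment> \<open>The two end values of \<open>k\<close> give the terms with \<open>x\<close>
        and \<open>t\<close>; in between \<open>w k\<close> is just \<open>q ^ k\<close>.\<close>
      have "{..2 * m + 1} = insert 0 (insert (2 * m + 1) {1..2 * m})" by auto
      moreover have "sum w {1..2 * m} = (\<Sum>k=1..2*m. q ^ k)"
        by (intro sum.cong) (auto simp: w_def)
      ultimately show ?thesis by (simp add: w_def algebra_simps)
    qed
    finally show ?case using Suc.IH by simp
  qed
  then show ?thesis by (simp add: W_def rl_Min0_eq rl_Min1_eq)
qed

end
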